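(* Let $X$ be a finite set, $A=X$, let $H$ be a Hilbert space and let $E=(E_{x,x',a,a'})_{x,x',a,a'}\in (M_{XA}\otimes \mathcal{B}(H))^+$. The following are equivalent: (i) $E$ is a bistochastic operator matrix; (ii) there exist a Hilbert space $K$ and operators $V_{a,x}\in \mathcal{B}(H,K)$, $x,a\in X$, such that $(V_{a,x})_{a,x\in X}$ is a bi-isometry and $E_{x,x',a,a'}=V_{a,x}^*V_{a',x'}$ for all $x,x',a,a'\in X$.
   Context: $M_X$ is the algebra of complex $X\times X$ matrices with matrix units $\epsilon_{x,x'}$, and $M_{XA}=M_X\otimes M_A$, where $A=X$. An element $E\in M_{XA}\otimes\mathcal{B}(H)$ is written $E=\sum_{x,x',a,a'}\epsilon_{x,x'}\otimes\epsilon_{a,a'}\otimes E_{x,x',a,a'}$ with $E_{x,x',a,a'}\in\mathcal{B}(H)$, and is regarded as an operator on $\mathbb{C}^X\otimes\mathbb{C}^A\otimes H$. A bistochastic operator matrix is an $E\in (M_{XA}\otimes \mathcal{B}(H))^+$ with $\mathrm{Tr}_A E=I_X\otimes I_H$ and $\mathrm{Tr}_X E=I_A\otimes I_H$, that is, $\sum_{a\in X}E_{x,x',a,a}=\delta_{x,x'}I_H$ for all $x,x'$ and $\sum_{x\in X}E_{x,x,a,a'}=\delta_{a,a'}I_H$ for all $a,a'$. A block operator matrix $V=(V_{a,x})_{a,x\in X}$ with $V_{a,x}\in\mathcal{B}(H,K)$ is a bi-isometry if both $V$ and its block transpose $V^{\rm t}$ (whose $(x,a)$-entry is $V_{a,x}$)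 are isometries as operators from $H^X=\oplus_{x\in X}H$ to $K^X$. *)

theory Defs
  imports "HOL-Analysis.Analysis"
begin

text \<open>
  A complex inner product space is a real one (with the real part of the complex inner product
  as its real inner product, so that the norm and the topology are the usual ones) carrying a
  compatible complex structure. The inner product is linear in its first argument.
\<close>

class complex_inner = real_inner +
  fixes scaleC :: "complex \<Rightarrow> 'a \<Rightarrow> 'a"  (infixr \<open>*\<^sub>C\<close> 75)
    and cinner :: "'a \<Rightarrow> 'a \<Rightarrow> complex"
  assumes scaleC_add_right: "c *\<^sub>C (x + y) = c *\<^sub>C x + c *\<^sub>C y"
    and scaleC_add_left: "(c + d) *\<^sub>C x = c *\<^sub>C x + d *\<^sub>C x"
    and scaleC_scaleC: "c *\<^sub>C d *\<^sub>C x = (c * d) *\<^sub>C x"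
    and scaleC_of_real: "complex_of_real r *\<^sub>C x = r *\<^sub>R x"
    and cinner_commute: "cinner x y = cnj (cinner y x)"
    and cinner_add_left: "cinner (x + y) z = cinner x z + cinner y z"
    and cinner_scaleC_left: "cinner (c *\<^sub>C x) y = c * cinner x y"
    and inner_eq_Re_cinner: "inner x y = Re (cinner x y)"

class chilbert_space = complex_inner + complete_space

instantiation complex :: chilbert_space
begin
definition "scaleC_complex (c::complex) (x::complex) = c * x"
definition "cinner_complex (x::complex) y = x * cnj y"
instance
  by standard
    (simp_all add: scaleC_complex_def cinner_complex_def algebra_simps scaleR_conv_of_real
      inner_complex_def)
end

text \<open>
  The finite direct sum, written \<open>'h ^ 'n\<close>. It renders \<open>H\<^sup>X\<close> and, with
  index type \<open>'x \<times> 'x\<close>, the tensor product of \<open>\<complex>\<^sup>X\<close>, \<open>\<complex>\<^sup>A\<close> and \<open>H\<close>.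
\<close>

instantiation vec :: (complex_inner, finite) complex_inner
begin
definition "scaleC_vec c (x :: 'a ^ 'b) = (\<chi> i. c *\<^sub>C (x $ i))"
definition "cinner_vec (x :: 'a ^ 'b) y = (\<Sum>i\<in>UNIV. cinner (x $ i) (y $ i))"
instance
proof
  fix x y :: "'a ^ 'b"
  show "cinner x y = cnj (cinner y x)"
    unfolding cinner_vec_def cnj_sum by (rule sum.cong[OF refl], rule cinner_commute)
qed (simp_all add: scaleC_vec_def cinner_vec_def vec_eq_iff scaleC_add_right scaleC_add_left
      scaleC_scaleC scaleC_of_real cinner_add_left cinner_scaleC_left sum.distrib
      sum_distrib_left inner_vec_def inner_eq_Re_cinner)
end

instance vec :: (chilbert_space, finite) chilbert_space ..

text \<open>
  The closed complex subspaces of a Hilbert space are Hilbert spaces in their own right. They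
  serve to quantify existentially over Hilbert spaces, since types cannot be quantified over: the
  existence of a Hilbert space is stated within a fixed ambient one, and what holds for every
  Hilbert space is stated for an arbitrary ambient type.
\<close>

definition hilbert_subspace :: "'k::chilbert_space set \<Rightarrow> bool" where
  "hilbert_subspace K \<longleftrightarrow> subspace K \<and> (\<forall>c. \<forall>v\<in>K. c *\<^sub>C v \<in> K) \<and> closed K"

definition bounded_clinear :: "('h::complex_inner \<Rightarrow> 'k::complex_inner) \<Rightarrow> bool" where
  "bounded_clinear T \<longleftrightarrow> bounded_linear T \<and> (\<forall>c v. T (c *\<^sub>C v) = c *\<^sub>C T v)"

definition bounded_operators :: "'h::complex_inner set \<Rightarrow> 'k::complex_inner set \<Rightarrow> ('h \<Rightarrow> 'k) set"
  where "bounded_operators H K = {T. bounded_clinear T \<and> T ` H \<subseteq> K}"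

text \<open>
  On Hilbert spaces the adjoint of a bounded operator exists (Riesz) and is unique. For an
  operator with range in a closed subspace \<open>K\<close>, the adjoint of the corestriction to \<open>K\<close> is the
  restriction of this adjoint to \<open>K\<close>.
\<close>

definition cadjoint :: "('h::complex_inner \<Rightarrow> 'k::complex_inner) \<Rightarrow> 'k \<Rightarrow> 'h" where
  "cadjoint T = (SOME S. \<forall>v w. cinner (T v) w = cinner v (S w))"

definition positive_operator :: "('h::complex_inner \<Rightarrow> 'h) \<Rightarrow> bool" where
  "positive_operator T \<longleftrightarrow>
     bounded_clinear T \<and> (\<forall>v. cinner (T v) v \<in> \<real> \<and> 0 \<le> Re (cinner (T v) v))"

definition isometry :: "('h::complex_inner \<Rightarrow> 'k::complex_inner) \<Rightarrow> bool" where
  "isometry T \<longleftrightarrow> bounded_clinear T \<and> (\<forall>v. norm (T v) = norm v)"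

text \<open>
  An element of \<open>M\<^bsub>XA\<^esub> \<otimes> B(H)\<close> is given by its blocks, \<open>E x x' a a'\<close> being the coefficient of
  \<open>\<epsilon>\<^bsub>x,x'\<^esub> \<otimes> \<epsilon>\<^bsub>a,a'\<^esub>\<close>; the finite set \<open>X = A\<close> is the index type \<open>'x\<close>.
\<close>

type_synonym ('x, 'h) op_matrix = "'x \<Rightarrow> 'x \<Rightarrow> 'x \<Rightarrow> 'x \<Rightarrow> 'h \<Rightarrow> 'h"

definition op_matrix_operator ::
    "('x::finite, 'h::complex_inner) op_matrix \<Rightarrow> 'h ^ ('x \<times> 'x) \<Rightarrow> 'h ^ ('x \<times> 'x)" where
  "op_matrix_operator E \<xi> =
     (\<chi> p. \<Sum>x'\<in>UNIV. \<Sum>a'\<in>UNIV. E (fst p) x' (snd p) a' (\<xi> $ (x', a')))"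

definition positive_op_matrix :: "('x::finite, 'h::chilbert_space) op_matrix \<Rightarrow> bool" where
  "positive_op_matrix E \<longleftrightarrow>
     (\<forall>x x' a a'. E x x' a a' \<in> bounded_operators UNIV UNIV) \<and>
     positive_operator (op_matrix_operator E)"

definition trace_A :: "('x::finite, 'h::complex_inner) op_matrix \<Rightarrow> 'x \<Rightarrow> 'x \<Rightarrow> 'h \<Rightarrow> 'h" where
  "trace_A E x x' = (\<lambda>v. \<Sum>a\<in>UNIV. E x x' a a v)"

definition trace_X :: "('x::finite, 'h::complex_inner) op_matrix \<Rightarrow> 'x \<Rightarrow> 'x \<Rightarrow> 'h \<Rightarrow> 'h" where
  "trace_X E a a' = (\<lambda>v. \<Sum>x\<in>UNIV. E x x a a' v)"

definition block_identity :: "'x \<Rightarrow> 'x \<Rightarrow> 'h::complex_inner \<Rightarrow> 'h" where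
  "block_identity y y' = (\<lambda>v. if y = y' then v else 0)"

definition bistochastic :: "('x::finite, 'h::chilbert_space) op_matrix \<Rightarrow> bool" where
  "bistochastic E \<longleftrightarrow>
     positive_op_matrix E \<and> trace_A E = block_identity \<and> trace_X E = block_identity"

text \<open>The first index of a block operator matrix is the row.\<close>

definition block_operator ::
    "('x::finite \<Rightarrow> 'x \<Rightarrow> 'h::complex_inner \<Rightarrow> 'k::complex_inner) \<Rightarrow> 'h ^ 'x \<Rightarrow> 'k ^ 'x" where
  "block_operator V \<xi> = (\<chi> a. \<Sum>x\<in>UNIV. V a x (\<xi> $ x))"

definition block_transpose :: "('x \<Rightarrow> 'x \<Rightarrow> 'h \<Rightarrow> 'k) \<Rightarrow> 'x \<Rightarrow> 'x \<Rightarrow> 'h \<Rightarrow> 'k" where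
  "block_transpose V x a = V a x"

definition bi_isometry ::
    "'k::chilbert_space set \<Rightarrow> ('x::finite \<Rightarrow> 'x \<Rightarrow> 'h::chilbert_space \<Rightarrow> 'k) \<Rightarrow> bool" where
  "bi_isometry K V \<longleftrightarrow>
     (\<forall>a x. V a x \<in> bounded_operators UNIV K) \<and>
     isometry (block_operator V) \<and> isometry (block_operator (block_transpose V))"

end

theory Submission imports Defs
begin

text \<open>
  Suppose first that the blocks of \<open>E\<close> are \<open>V\<^bsub>a,x\<^esub>\<^sup>* V\<^bsub>a',x'\<^esub>\<close>. Then the \<open>(x,x')\<close> block of
  \<open>Tr\<^sub>A E\<close> is \<open>\<Sum>\<^sub>a V\<^bsub>a,x\<^esub>\<^sup>* V\<^bsub>a,x'\<^esub>\<close>, which is the \<open>(x,x')\<close> block of \<open>V\<^sup>* V\<close>; likewise \<open>Tr\<^sub>X E\<close> is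
  the product of the block transpose of \<open>V\<close> with its own adjoint on the left. So the two trace
  conditions say exactly that \<open>V\<close> and its block transpose are isometries
  (\<open>bi_isometry_iff_traces\<close>), and the equivalence is reduced to the existence of a factorisation.

  Such a factorisation exists for every positive \<open>E\<close> (\<open>positive_op_matrix_factorisation\<close>): let
  \<open>T\<close> be a self-adjoint square root of the operator \<open>E\<close> on \<open>\<complex>\<^sup>X \<otimes> \<complex>\<^sup>A \<otimes> H\<close>, and let \<open>V\<^bsub>a,x\<^esub>\<close> be the
  restriction of \<open>T\<close> to the summand with index \<open>(x,a)\<close>. As \<open>T\<^sup>* T = E\<close>, the operator
  \<open>V\<^bsub>a,x\<^esub>\<^sup>* V\<^bsub>a',x'\<^esub>\<close> is the block of \<open>E\<close> in row \<open>(x,a)\<close> and column \<open>(x',a')\<close>. Using the square root,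
  rather than the completion of the space under the form that \<open>E\<close> defines, lets
  \<open>\<complex>\<^sup>X \<otimes> \<complex>\<^sup>A \<otimes> H\<close> itself serve as \<open>K\<close>.

  Two facts of Hilbert space theory carry the argument. The square root comes from the binomial
  series of \<open>\<surd>(1 - t)\<close>, whose coefficients are absolutely summable, so that \<open>1\<close> may be replaced by
  the identity and \<open>t\<close> by any contraction (\<open>positive_operator_sqrt\<close>). Adjoints exist by the Riesz
  representation theorem (\<open>riesz_representation\<close>). Both are proved for real Hilbert spaces; a
  real linear operator is complex linear if and only if it commutes with the complex scalars, and the imaginary
  part of the complex inner product is recovered from the real inner product and multiplication by
  \<open>\<i>\<close>.
\<close>

section \<open>The binomial series of the square root\<close>

text \<open>
  The coefficient of \<open>t\<^sup>n\<close> in the power series of \<open>\<surd>(1 - t)\<close>.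
\<close>

definition sqrt_coeff :: "nat \<Rightarrow> real" where
  "sqrt_coeff n = (-1) ^ n * ((1/2) gchoose n)"

lemma sqrt_coeff_0 [simp]: "sqrt_coeff 0 = 1"
  by (simp add: sqrt_coeff_def)

text \<open>
  Only the constant coefficient is positive. Hence a bound from below on the partial sums of the
  coefficients is a bound from above on those of their absolute values, which gives the
  summability up to the boundary of the disc of convergence that contractions of norm \<open>1\<close> need.
\<close>

lemma sqrt_coeff_Suc_nonpos: "sqrt_coeff (Suc n) \<le> 0"
proof -
  have "sqrt_coeff (Suc n) = pochhammer (- (1/2)) (Suc n) / fact (Suc n)"
    by (simp add: sqrt_coeff_def gbinomial_pochhammer flip: power_mult_distrib mult.assoc)
  also have "\<dots> = - (1/2) * pochhammer (1/2) n / fact (Suc n)"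
    by (simp add: pochhammer_rec)
  also have "\<dots> \<le> 0"
    by (simp add: pochhammer_nonneg)
  finally show ?thesis .
qed

lemma sum_sqrt_coeff_nonneg: "0 \<le> (\<Sum>k\<le>m. sqrt_coeff k)"
proof -
  have "(\<Sum>k\<le>m. sqrt_coeff k) = (-1) ^ m * ((- (1/2)) gchoose m)"
    using gbinomial_sum_lower_neg[of "1/2 :: real" m]
    by (simp add: sqrt_coeff_def mult.commute)
  also have "\<dots> = pochhammer (1/2) m / fact m"
    by (simp add: gbinomial_pochhammer flip: power_mult_distrib mult.assoc)
  also have "\<dots> \<ge> 0"
    by (simp add: pochhammer_nonneg)
  finally show ?thesis .
qed

lemma summable_abs_sqrt_coeff: "summable (\<lambda>n. \<bar>sqrt_coeff n\<bar>)"
proof (rule bounded_imp_summable)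
  fix n
  have "(\<Sum>k\<le>n. \<bar>sqrt_coeff k\<bar>) = 2 - (\<Sum>k\<le>n. sqrt_coeff k)"
    by (induction n) (use sqrt_coeff_Suc_nonpos in \<open>auto simp: abs_of_nonpos\<close>)
  then show "(\<Sum>k\<le>n. \<bar>sqrt_coeff k\<bar>) \<le> 2"
    using sum_sqrt_coeff_nonneg[of n] by simp
qed simp

text \<open>
  This is \<open>(\<surd>(1 - t))\<^sup>2 = 1 - t\<close> read off the coefficients; for binomial coefficients it is
  Vandermonde's identity \<open>\<Sum>\<^sub>i (1/2 choose i) (1/2 choose k - i) = (1 choose k)\<close>.
\<close>

lemma sqrt_coeff_convolution:
  "(\<Sum>i\<le>k. sqrt_coeff i * sqrt_coeff (k - i)) = (if k = 0 then 1 else if k = 1 then -1 else 0)"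
proof -
  have "(\<Sum>i\<le>k. sqrt_coeff i * sqrt_coeff (k - i))
      = (\<Sum>i\<le>k. (-1) ^ k * (((1/2) gchoose i) * ((1/2) gchoose (k - i))))"
  proof (rule sum.cong[OF refl])
    fix i assume "i \<in> {..k}"
    then have "(-1) ^ k = (-1) ^ i * (-1 :: real) ^ (k - i)"
      by (simp flip: power_add)
    then show "sqrt_coeff i * sqrt_coeff (k - i)
        = (-1) ^ k * (((1/2) gchoose i) * ((1/2) gchoose (k - i)))"
      by (simp add: sqrt_coeff_def)
  qed
  also have "\<dots> = (-1) ^ k * (1 gchoose k)"
    using gbinomial_Vandermonde[of "1/2 :: real" "1/2" k]
    by (simp add: atMost_atLeast0 flip: sum_distrib_left)
  also have "(1 gchoose k) = (of_nat (1 choose k) :: real)"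
    by (metis binomial_gbinomial of_nat_1)
  finally show ?thesis
    by (cases k rule: nat.exhaust; cases "k - 1") auto
qed

section \<open>Square roots of positive operators\<close>

lemma bounded_linear_funpow:
  fixes A :: "'a::real_normed_vector \<Rightarrow> 'a"
  assumes "bounded_linear A"
  shows "bounded_linear (A ^^ n)"
proof (induction n)
  case 0
  have "A ^^ 0 = (\<lambda>v. v)" by (simp add: fun_eq_iff)
  then show ?case by (simp only: bounded_linear_ident)
next
  case (Suc n)
  then show ?case using bounded_linear_compose[OF assms Suc] by (simp add: o_def)
qed

lemma infsum_bounded_linear:
  assumes "bounded_linear h" and "f summable_on I"
  shows "(\<Sum>\<^sub>\<infinity>i\<in>I. h (f i)) = h (infsum f I)"
  by (rule infsumI[OF has_sum_bounded_linear[OF assms(1) has_sum_infsum[OF assms(2)]]])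

locale contraction =
  fixes A :: "'a::banach \<Rightarrow> 'a"
  assumes bounded_linear: "bounded_linear A"
    and norm_le: "norm (A v) \<le> norm v"
begin

definition sqrt_one_minus :: "'a \<Rightarrow> 'a" where
  "sqrt_one_minus v = (\<Sum>\<^sub>\<infinity>n. sqrt_coeff n *\<^sub>R (A ^^ n) v)"

lemma norm_funpow_le: "norm ((A ^^ n) v) \<le> norm v"
  by (induction n) (auto intro: order_trans[OF norm_le])

lemma abs_summable: "(\<lambda>n. norm (sqrt_coeff n *\<^sub>R (A ^^ n) v)) summable_on UNIV"
proof (rule Infinite_Sum.abs_summable_on_comparison_test)
  have "(\<lambda>n. \<bar>sqrt_coeff n\<bar>) summable_on UNIV"
    using summable_abs_sqrt_coeff by (simp add: norm_summable_imp_summable_on)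
  then show "(\<lambda>n. norm (\<bar>sqrt_coeff n\<bar> * norm v)) summable_on UNIV"
    by (simp add: abs_mult summable_on_cmult_left)
  show "norm (sqrt_coeff n *\<^sub>R (A ^^ n) v) \<le> norm (\<bar>sqrt_coeff n\<bar> * norm v)" for n
    using norm_funpow_le[of n v] by (simp add: abs_mult mult_left_mono)
qed

lemma summable: "(\<lambda>n. sqrt_coeff n *\<^sub>R (A ^^ n) v) summable_on UNIV"
  using abs_summable by (rule abs_summable_summable)

lemma bounded_linear_sqrt_one_minus: "bounded_linear sqrt_one_minus"
proof (rule bounded_linear_intro[where K = "\<Sum>\<^sub>\<infinity>n. \<bar>sqrt_coeff n\<bar>"])
  fix v w r
  interpret P: bounded_linear "A ^^ n" for n
    by (rule bounded_linear_funpow[OF bounded_linear])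
  show "sqrt_one_minus (v + w) = sqrt_one_minus v + sqrt_one_minus w"
    by (simp add: sqrt_one_minus_def P.add scaleR_add_right infsum_add summable)
  have "sqrt_one_minus (r *\<^sub>R v) = (\<Sum>\<^sub>\<infinity>n. r *\<^sub>R sqrt_coeff n *\<^sub>R (A ^^ n) v)"
    by (simp add: sqrt_one_minus_def P.scaleR mult.commute)
  then show "sqrt_one_minus (r *\<^sub>R v) = r *\<^sub>R sqrt_one_minus v"
    by (simp add: sqrt_one_minus_def infsum_scaleR_right del: scaleR_scaleR)
  have s: "(\<lambda>n. \<bar>sqrt_coeff n\<bar>) summable_on UNIV"
    using summable_abs_sqrt_coeff by (simp add: norm_summable_imp_summable_on)
  have "norm (sqrt_one_minus v) \<le> (\<Sum>\<^sub>\<infinity>n. norm (sqrt_coeff n *\<^sub>R (A ^^ n) v))"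
    unfolding sqrt_one_minus_def by (rule norm_infsum_bound[OF abs_summable])
  also have "\<dots> \<le> (\<Sum>\<^sub>\<infinity>n. \<bar>sqrt_coeff n\<bar> * norm v)"
    using norm_funpow_le[of _ v]
    by (intro infsum_mono abs_summable summable_on_cmult_left s) (simp add: mult_left_mono)
  also have "\<dots> = norm v * (\<Sum>\<^sub>\<infinity>n. \<bar>sqrt_coeff n\<bar>)"
    by (simp add: infsum_cmult_left' mult.commute[of "norm v"])
  finally show "norm (sqrt_one_minus v) \<le> norm v * (\<Sum>\<^sub>\<infinity>n. \<bar>sqrt_coeff n\<bar>)" .
qed

text \<open>
  Commuting with the commutant of \<open>A\<close> has two uses: applied to powers of \<open>A\<close> it lets the series be
  squared term by term, and applied to multiplication by complex scalars it makes square roots of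
  complex linear operators complex linear.
\<close>

lemma sqrt_one_minus_commute:
  assumes "bounded_linear B" and "\<And>v. A (B v) = B (A v)"
  shows "sqrt_one_minus (B v) = B (sqrt_one_minus v)"
proof -
  interpret B: bounded_linear B by fact
  have "(A ^^ n) (B w) = B ((A ^^ n) w)" for n w
    by (induction n) (simp_all add: assms(2))
  then have "sqrt_one_minus (B v) = (\<Sum>\<^sub>\<infinity>n. B (sqrt_coeff n *\<^sub>R (A ^^ n) v))"
    by (simp add: sqrt_one_minus_def B.scaleR)
  also have "\<dots> = B (sqrt_one_minus v)"
    unfolding sqrt_one_minus_def
    by (rule infsum_bounded_linear[OF assms(1) summable])
  finally show ?thesis .
qed

text \<open>
  The Cauchy product: the double series over \<open>(n, m)\<close> converges absolutely, so it may be summed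
  along the diagonals \<open>n + m = k\<close>, where the coefficients add up to those of \<open>1 - t\<close>.
\<close>

lemma sqrt_one_minus_sqrt_one_minus: "sqrt_one_minus (sqrt_one_minus v) = v - A v"
proof -
  interpret P: bounded_linear "A ^^ n" for n
    by (rule bounded_linear_funpow[OF bounded_linear])
  let ?g = "\<lambda>(n, m). (sqrt_coeff n * sqrt_coeff m) *\<^sub>R (A ^^ (n + m)) v"
  let ?h = "\<lambda>(k, i). (sqrt_coeff i * sqrt_coeff (k - i)) *\<^sub>R (A ^^ k) v"
  have "(\<lambda>p. norm (?g p)) summable_on UNIV \<times> UNIV"
  proof (rule Infinite_Sum.abs_summable_on_comparison_test)
    have "(\<lambda>n. norm (sqrt_coeff n)) summable_on UNIV"
      using summable_abs_sqrt_coeff by (simp add: norm_summable_imp_summable_on)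
    then have "(\<lambda>p. norm (sqrt_coeff (fst p) * sqrt_coeff (snd p))) summable_on UNIV \<times> UNIV"
      unfolding Infinite_Sum.abs_summable_on_Sigma_iff
      by (auto simp: abs_mult infsum_cmult_right intro!: summable_on_cmult_right summable_on_cmult_left)
    then show "(\<lambda>p. norm (sqrt_coeff (fst p) * sqrt_coeff (snd p) * norm v))
        summable_on UNIV \<times> UNIV"
      unfolding norm_mult by (intro summable_on_cmult_left)
    show "norm (?g p) \<le> norm (sqrt_coeff (fst p) * sqrt_coeff (snd p) * norm v)" for p
      by (auto simp: abs_mult split: prod.split intro!: mult_left_mono norm_funpow_le)
  qed
  then have g: "?g summable_on UNIV \<times> UNIV"
    by (rule abs_summable_summable)
  have bij: "bij_betw (\<lambda>(k, i). (i, k - i)) (SIGMA k:UNIV. {..k}) (UNIV \<times> (UNIV :: nat set))"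
    by (rule bij_betw_byWitness[where f' = "\<lambda>(n, m). (n + m, n)"]) auto
  have gh: "?g ((\<lambda>(k, i). (i, k - i)) p) = ?h p" if "p \<in> (SIGMA k:UNIV. {..k})" for p
    using that by auto
  have h: "?h summable_on (SIGMA k:UNIV. {..k})"
    using summable_on_reindex_bij_betw[OF bij, of ?g] g gh
    by (simp cong: summable_on_cong)
  have "sqrt_one_minus (sqrt_one_minus v)
      = (\<Sum>\<^sub>\<infinity>n. sqrt_coeff n *\<^sub>R sqrt_one_minus ((A ^^ n) v))"
    by (subst sqrt_one_minus_def)
      (simp add: sqrt_one_minus_commute[OF P.bounded_linear_axioms] flip: funpow_swap1)
  also have "\<dots> = (\<Sum>\<^sub>\<infinity>n. \<Sum>\<^sub>\<infinity>m. ?g (n, m))"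
    by (simp add: sqrt_one_minus_def infsum_scaleR_right add.commute
        flip: scaleR_scaleR o_apply[of "A ^^ _" "A ^^ _"] funpow_add)
  also have "\<dots> = infsum ?g (UNIV \<times> UNIV)"
    using infsum_Sigma'_banach[of "\<lambda>n m. ?g (n, m)" UNIV "\<lambda>_. UNIV"] g by simp
  also have "\<dots> = infsum ?h (SIGMA k:UNIV. {..k})"
    using infsum_reindex_bij_betw[OF bij, of ?g] gh by (simp cong: infsum_cong)
  also have "\<dots> = (\<Sum>\<^sub>\<infinity>k. \<Sum>i\<le>k. ?h (k, i))"
    using infsum_Sigma'_banach[of "\<lambda>k i. ?h (k, i)" UNIV "\<lambda>k. {..k}"] h by simp
  also have "\<dots> = (\<Sum>\<^sub>\<infinity>k. (if k = 0 then 1 else if k = 1 then -1 else 0) *\<^sub>R (A ^^ k) v)"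
    by (simp flip: scaleR_sum_left sqrt_coeff_convolution)
  also have "\<dots> = (\<Sum>\<^sub>\<infinity>k\<in>{0, 1}. (if k = 0 then 1 else if k = 1 then -1 else 0) *\<^sub>R (A ^^ k) v)"
    by (rule infsum_cong_neutral) auto
  also have "\<dots> = v - A v"
    by simp
  finally show ?thesis .
qed

end

text \<open>
  With \<open>t > 0\<close> the inverse of a bound on the norm of \<open>P\<close>, the operator \<open>A = 1 - t P\<close> is a contraction, and
  \<open>P = (1 - A) / t\<close> has the root \<open>\<surd>(1 - A) / \<surd>t\<close>.
\<close>

theorem positive_operator_sqrt:
  fixes P :: "'a::{real_inner, banach} \<Rightarrow> 'a"
  assumes "bounded_linear P"
    and sym: "\<And>v w. inner (P v) w = inner v (P w)"
    and pos: "\<And>v. 0 \<le> inner (P v) v"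
  obtains T where "bounded_linear T" and "\<And>v w. inner (T v) w = inner v (T w)"
    and "\<And>v. T (T v) = P v"
    and "\<And>B v. bounded_linear B \<Longrightarrow> (\<And>v. P (B v) = B (P v)) \<Longrightarrow> T (B v) = B (T v)"
proof -
  interpret P: bounded_linear P by fact
  obtain c where "c > 0" and c: "\<And>v. norm (P v) \<le> norm v * c"
    using P.pos_bounded by blast
  define t where "t = 1 / c"
  have "t > 0" using \<open>c > 0\<close> by (simp add: t_def)
  define A where "A v = v - t *\<^sub>R P v" for v
  have A: "bounded_linear A"
    unfolding A_def
    by (intro bounded_linear_sub bounded_linear_ident bounded_linear_scaleR_right
        bounded_linear_compose[OF bounded_linear_scaleR_right assms(1)])
  have "norm (A v) \<le> norm v" for v
  proof -
    \<comment> \<open>Positivity of \<open>P\<close> at the vector \<open>A v\<close> turns this bound into \<open>t \<parallel>P v\<parallel>\<^sup>2 \<le> \<langle>P v, v\<rangle>\<close>,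
      and \<open>\<parallel>A v\<parallel>\<^sup>2 = \<parallel>v\<parallel>\<^sup>2 - 2 t \<langle>P v, v\<rangle> + t\<^sup>2 \<parallel>P v\<parallel>\<^sup>2\<close>.\<close>
    have "inner (P (P v)) (P v) \<le> c * inner (P v) (P v)"
    proof -
      have "inner (P (P v)) (P v) \<le> norm (P (P v)) * norm (P v)"
        by (rule norm_cauchy_schwarz)
      also have "\<dots> \<le> (norm (P v) * c) * norm (P v)"
        by (intro mult_right_mono c) simp
      finally show ?thesis by (simp add: dot_square_norm power2_eq_square mult_ac)
    qed
    then have "t\<^sup>2 * inner (P (P v)) (P v) \<le> t * inner (P v) (P v)"
      using \<open>c > 0\<close> by (simp add: t_def field_simps power2_eq_square)
    moreover have "0 \<le> inner (P (A v)) (A v)" by (rule pos)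
    moreover have "inner (P (A v)) (A v)
        = inner (P v) v - 2 * t * inner (P v) (P v) + t\<^sup>2 * inner (P (P v)) (P v)"
      using sym[of "P v" v]
      by (simp add: A_def P.diff P.scaleR inner_diff_left inner_diff_right power2_eq_square
          algebra_simps)
    ultimately have "t * inner (P v) (P v) \<le> inner (P v) v" by simp
    then have "t * (t * inner (P v) (P v)) \<le> t * inner (P v) v"
      using \<open>t > 0\<close> by (intro mult_left_mono) auto
    moreover have "0 \<le> t * inner (P v) v" using pos[of v] \<open>t > 0\<close> by simp
    moreover have "inner (A v) (A v)
        = inner v v - 2 * (t * inner (P v) v) + t * (t * inner (P v) (P v))"
      by (simp add: A_def inner_diff_left inner_diff_right inner_commute[of v "P v"]
          algebra_simps)
    ultimately have "inner (A v) (A v) \<le> inner v v" by linarith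
    then show ?thesis by (simp add: norm_le)
  qed
  with A interpret contraction A by (rule contraction.intro)
  define T where "T v = sqrt c *\<^sub>R sqrt_one_minus v" for v
  interpret R: bounded_linear sqrt_one_minus by (rule bounded_linear_sqrt_one_minus)
  have powsym: "inner ((A ^^ n) v) w = inner v ((A ^^ n) w)" for n v w
  proof (induction n arbitrary: w)
    case (Suc n)
    have "inner (A x) y = inner x (A y)" for x y
      by (simp add: A_def inner_diff_left inner_diff_right sym)
    then have "inner ((A ^^ Suc n) v) w = inner ((A ^^ n) v) (A w)" by simp
    also have "\<dots> = inner v ((A ^^ Suc n) w)" by (simp add: Suc funpow_swap1)
    finally show ?case .
  qed simp
  show thesis
  proof
    show "bounded_linear T"
      unfolding T_def
      by (intro bounded_linear_compose[OF bounded_linear_scaleR_right] bounded_linear_sqrt_one_minus)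
    show "inner (T v) w = inner v (T w)" for v w
    proof -
      have "inner (sqrt_one_minus v) w = (\<Sum>\<^sub>\<infinity>n. inner (sqrt_coeff n *\<^sub>R (A ^^ n) v) w)"
        unfolding sqrt_one_minus_def
        by (rule infsum_bounded_linear[OF bounded_linear_inner_left summable, symmetric])
      also have "\<dots> = (\<Sum>\<^sub>\<infinity>n. inner (sqrt_coeff n *\<^sub>R (A ^^ n) w) v)"
        by (simp add: powsym inner_commute[of v])
      also have "\<dots> = inner (sqrt_one_minus w) v"
        unfolding sqrt_one_minus_def
        by (rule infsum_bounded_linear[OF bounded_linear_inner_left summable])
      finally show ?thesis by (simp add: T_def inner_commute)
    qed
    show "T (T v) = P v" for v
      using \<open>c > 0\<close> by (simp add: T_def R.scaleR sqrt_one_minus_sqrt_one_minus A_def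
          t_def)
    show "T (B v) = B (T v)" if "bounded_linear B" "\<And>v. P (B v) = B (P v)" for B v
    proof -
      interpret B: bounded_linear B by fact
      have "A (B w) = B (A w)" for w
        by (simp add: A_def B.diff B.scaleR that)
      then show ?thesis
        by (simp add: T_def B.scaleR sqrt_one_minus_commute[OF that(1)])
    qed
  qed
qed

section \<open>Adjoints\<close>

text \<open>
  The representing vector is the minimiser of \<open>J v = \<parallel>v\<parallel>\<^sup>2 - 2 f v\<close>, a quadratic functional that
  is bounded below. By the parallelogram law a minimising sequence is Cauchy, and at the minimum
  the derivative \<open>2 \<langle>v, u\<rangle> - 2 f v\<close> of \<open>J\<close> vanishes in every direction \<open>v\<close>.
\<close>

lemma riesz_representation:
  fixes f :: "'a::{real_inner, banach} \<Rightarrow> real"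
  assumes "bounded_linear f"
  obtains w where "\<And>v. f v = inner v w"
proof -
  interpret bounded_linear f by fact
  define J where "J v = (norm v)\<^sup>2 - 2 * f v" for v
  obtain K where K: "\<And>v. norm (f v) \<le> norm v * K" using bounded by blast
  have "- K\<^sup>2 \<le> J v" for v
  proof -
    have "f v \<le> norm v * K" using K[of v] by simp
    moreover have "0 \<le> (norm v - K)\<^sup>2" by simp
    ultimately show ?thesis by (simp add: J_def power2_diff)
  qed
  then have bdd: "bdd_below (range J)" by (auto simp: bdd_below_def)
  define m where "m = Inf (range J)"
  have mle: "m \<le> J v" for v unfolding m_def by (simp add: bdd cInf_lower)
  have "\<exists>v. J v < m + inverse (Suc n)" for n
    using cInf_lessD[of "range J" "m + inverse (Suc n)"] by (auto simp: m_def)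
  then obtain w where w: "\<And>n. J (w n) < m + inverse (real (Suc n))" by metis
  have par: "(norm (x - y))\<^sup>2 = 2 * J x + 2 * J y - 4 * J ((1/2) *\<^sub>R (x + y))" for x y
    by (simp add: J_def power2_norm_eq_inner add scaleR inner_add_left inner_add_right
        inner_diff_left inner_diff_right inner_commute algebra_simps)
  have close: "(norm (w i - w j))\<^sup>2 \<le> 2 * inverse (real (Suc i)) + 2 * inverse (real (Suc j))" for i j
    using par[of "w i" "w j"] w[of i] w[of j] mle[of "(1/2) *\<^sub>R (w i + w j)"] by linarith
  have "Cauchy w"
  proof (rule metric_CauchyI)
    fix e :: real assume "e > 0"
    then obtain N where N: "inverse (real (Suc N)) < e\<^sup>2 / 4"
      using reals_Archimedean[of "e\<^sup>2 / 4"] by auto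
    have "dist (w i) (w j) < e" if "i \<ge> N" "j \<ge> N" for i j
    proof -
      have "inverse (real (Suc k)) \<le> inverse (real (Suc N))" if "k \<ge> N" for k
        using that by (simp add: field_simps)
      from this[OF that(1)] this[OF that(2)] have "(norm (w i - w j))\<^sup>2 < e\<^sup>2"
        using close[of i j] N by linarith
      then show ?thesis using \<open>e > 0\<close> by (simp add: dist_norm power2_less_imp_less)
    qed
    then show "\<exists>M. \<forall>i\<ge>M. \<forall>j\<ge>M. dist (w i) (w j) < e" by blast
  qed
  then obtain u where u: "w \<longlonglongrightarrow> u" using Cauchy_convergent_iff convergent_def by blast
  have "(\<lambda>n. J (w n)) \<longlonglongrightarrow> J u"
    unfolding J_def by (intro tendsto_intros u tendsto)
  moreover have "(\<lambda>n. m + inverse (real (Suc n))) \<longlonglongrightarrow> m + 0"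
    by (intro tendsto_intros LIMSEQ_inverse_real_of_nat)
  ultimately have "J u \<le> m + 0"
    using w by (intro LIMSEQ_le) (auto intro: less_imp_le)
  then have umin: "J u \<le> J v" for v using mle[of v] by simp
  have "f v = inner v u" for v
  proof (rule ccontr)
    define d where "d = f v - inner v u"
    assume "f v \<noteq> inner v u"
    then have "d \<noteq> 0" by (simp add: d_def)
    then have "v \<noteq> 0" by (auto simp: d_def zero)
    define N where "N = (norm v)\<^sup>2"
    have "N > 0" using \<open>v \<noteq> 0\<close> by (simp add: N_def)
    have "J (u + t *\<^sub>R v) = J u - 2 * t * d + t\<^sup>2 * N" for t
      unfolding J_def d_def N_def power2_norm_eq_inner
      by (simp add: add scaleR inner_add_left inner_add_right inner_commute power2_eq_square
          algebra_simps)
    \<comment> \<open>The parabola in the step length is lowest at \<open>d / N\<close>, where it lies \<open>d\<^sup>2 / N\<close> below \<open>J u\<close>.\<close>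
    from this[of "d / N"] umin[of "u + (d / N) *\<^sub>R v"]
    have "2 * (d / N) * d \<le> (d / N)\<^sup>2 * N" by simp
    then have "d\<^sup>2 \<le> 0" using \<open>N > 0\<close> by (simp add: field_simps power2_eq_square)
    with \<open>d \<noteq> 0\<close> show False by simp
  qed
  then show thesis by (rule that)
qed

instance chilbert_space \<subseteq> banach ..

lemma cinner_scaleC_right: "cinner x (c *\<^sub>C y) = cnj c * cinner x y"
  by (metis cinner_commute cinner_scaleC_left complex_cnj_mult)

lemma Im_cinner: "Im (cinner x y) = - inner (\<i> *\<^sub>C x) y"
  by (simp add: inner_eq_Re_cinner cinner_scaleC_left)

lemma Im_cinner': "Im (cinner x y) = inner x (\<i> *\<^sub>C y)"
  by (simp add: inner_eq_Re_cinner cinner_scaleC_right)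

lemma Im_cinner_self: "Im (cinner x x) = 0"
  by (metis cinner_commute complex_cnj_cancel_iff Reals_cnj_iff complex_is_Real_iff)

lemma norm_scaleC: "norm (c *\<^sub>C x) = cmod c * norm x"
proof -
  have "(norm (c *\<^sub>C x))\<^sup>2 = (cmod c * norm x)\<^sup>2"
    unfolding power_mult_distrib cmod_power2 power2_norm_eq_inner
    by (simp add: inner_eq_Re_cinner cinner_scaleC_left cinner_scaleC_right power2_eq_square
        algebra_simps complex_mult_cnj Im_cinner_self)
  then show ?thesis by simp
qed

lemma bounded_linear_scaleC: "bounded_linear ((*\<^sub>C) c)"
proof (rule bounded_linear_intro[where K = "cmod c"])
  show "c *\<^sub>C r *\<^sub>R x = r *\<^sub>R c *\<^sub>C x" for r :: real and x :: 'a
    by (simp add: scaleC_scaleC mult.commute flip: scaleC_of_real)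
qed (simp_all add: scaleC_add_right norm_scaleC mult.commute)

text \<open>
  Adjoint relations need to be checked for the real inner product only: the imaginary parts follow
  from the real ones at \<open>\<i> v\<close>.
\<close>

lemma cinner_eqI_inner:
  assumes "\<And>c v. T (c *\<^sub>C v) = c *\<^sub>C T v"
    and "\<And>v. inner (T v) w = inner v u"
  shows "cinner (T v) w = cinner v u"
proof (rule complex_eqI)
  show "Re (cinner (T v) w) = Re (cinner v u)"
    using assms(2)[of v] by (simp add: inner_eq_Re_cinner)
  show "Im (cinner (T v) w) = Im (cinner v u)"
    using assms(2)[of "\<i> *\<^sub>C v"] by (simp add: Im_cinner assms(1))
qed

text \<open>
  Riesz representation supplies an operator that satisfies the adjoint relation, so that the choice
  in the definition of \<open>cadjoint\<close> picks one that does.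
\<close>

lemma cinner_cadjoint:
  fixes T :: "'h::chilbert_space \<Rightarrow> 'k::complex_inner"
  assumes "bounded_clinear T"
  shows "cinner (T v) w = cinner v (cadjoint T w)"
proof -
  have "\<exists>u. \<forall>v. cinner (T v) w = cinner v u" for w
  proof -
    have "bounded_linear (\<lambda>v. inner (T v) w)"
      using assms bounded_linear_compose[OF bounded_linear_inner_left]
      by (auto simp: bounded_clinear_def)
    then obtain u where "\<And>v. inner (T v) w = inner v u"
      by (rule riesz_representation) (rule that)
    with assms show ?thesis
      by (auto simp: bounded_clinear_def intro!: exI[of _ u] cinner_eqI_inner)
  qed
  then have "\<exists>S. \<forall>v w. cinner (T v) w = cinner v (S w)" by metis
  then have "\<forall>v w. cinner (T v) w = cinner v (cadjoint T w)"
    unfolding cadjoint_def by (rule someI_ex)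
  then show ?thesis by blast
qed

lemma inner_cadjoint:
  assumes "bounded_clinear (T :: 'h::chilbert_space \<Rightarrow> 'k::complex_inner)"
  shows "inner (cadjoint T w) v = inner w (T v)"
  using arg_cong[OF cinner_cadjoint[OF assms, of v w], of Re]
  by (metis inner_commute inner_eq_Re_cinner)

text \<open>
  Polarisation: since \<open>\<langle>T u, u\<rangle>\<close> is real, \<open>T u\<close> is orthogonal to \<open>\<i> u\<close> for the real inner product.
  At \<open>u = v + \<i> w\<close> the mixed terms of this relation give the symmetry.
\<close>

lemma positive_operator_symmetric:
  assumes "positive_operator T"
  shows "inner (T v) w = inner v (T w)"
proof -
  interpret T: bounded_linear T
    using assms by (simp add: positive_operator_def bounded_clinear_def)
  have Im: "Im (cinner (T u) u) = 0" for u
    using assms by (auto simp: positive_operator_def complex_is_Real_iff)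
  have "inner (T u) (\<i> *\<^sub>C u) = 0" for u
    using Im[of u] by (simp add: Im_cinner')
  moreover have "T (\<i> *\<^sub>C w) = \<i> *\<^sub>C T w"
    using assms by (simp add: positive_operator_def bounded_clinear_def)
  moreover have "inner (\<i> *\<^sub>C x) (\<i> *\<^sub>C y) = inner x y" for x y :: 'a
    by (simp add: inner_eq_Re_cinner cinner_scaleC_left cinner_scaleC_right)
  moreover have "\<i> *\<^sub>C \<i> *\<^sub>C w = - w"
    using scaleC_of_real[of "-1" w] by (simp add: scaleC_scaleC)
  moreover have "inner (T (v + \<i> *\<^sub>C w)) (\<i> *\<^sub>C (v + \<i> *\<^sub>C w))
      = inner (T v) (\<i> *\<^sub>C v) + inner (T (\<i> *\<^sub>C w)) (\<i> *\<^sub>C \<i> *\<^sub>C w)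
        + inner (T v) (\<i> *\<^sub>C \<i> *\<^sub>C w) + inner (T (\<i> *\<^sub>C w)) (\<i> *\<^sub>C v)"
    by (simp add: T.add scaleC_add_right inner_add_left inner_add_right)
  ultimately show ?thesis
    by (metis (no_types, opaque_lifting) add.left_neutral add.right_neutral add_eq_0_iff inner_commute
        inner_minus_right minus_minus)
qed

section \<open>Block operators\<close>

lemma bounded_linear_vec_lambda:
  assumes "\<And>i. bounded_linear (f i)"
  shows "bounded_linear (\<lambda>v. \<chi> i. f i v)"
proof (rule bounded_linear_intro[where K = "\<Sum>i\<in>UNIV. onorm (f i)"])
  interpret bounded_linear "f i" for i by (rule assms)
  fix v w r
  show "(\<chi> i. f i (v + w)) = (\<chi> i. f i v) + (\<chi> i. f i w)"
    by (simp add: vec_eq_iff add)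
  show "(\<chi> i. f i (r *\<^sub>R v)) = r *\<^sub>R (\<chi> i. f i v)"
    by (simp add: vec_eq_iff scaleR)
  have "norm (\<chi> i. f i v) \<le> (\<Sum>i\<in>UNIV. norm (f i v))"
    unfolding norm_vec_def by (rule order_trans[OF L2_set_le_sum]) auto
  also have "\<dots> \<le> (\<Sum>i\<in>UNIV. onorm (f i) * norm v)"
    by (intro sum_mono onorm assms)
  finally show "norm (\<chi> i. f i v) \<le> norm v * (\<Sum>i\<in>UNIV. onorm (f i))"
    by (simp add: sum_distrib_left mult.commute)
qed

lemma scaleC_axis: "c *\<^sub>C axis i v = axis i (c *\<^sub>C v)"
proof -
  have "c *\<^sub>C (0::'a) = 0"
    by (rule linear_0[OF bounded_linear.linear[OF bounded_linear_scaleC]])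
  then show ?thesis by (simp add: vec_eq_iff scaleC_vec_def axis_def)
qed

lemma bounded_linear_axis: "bounded_linear (axis i)"
proof (rule bounded_linear_intro[where K = 1])
  fix x :: 'a
  have "(\<Sum>j\<in>UNIV. (norm (axis i x $ j))\<^sup>2) = (\<Sum>j\<in>UNIV. if j = i then (norm x)\<^sup>2 else 0)"
    by (intro sum.cong) (auto simp: axis_def)
  then show "norm (axis i x) \<le> norm x * 1"
    by (simp add: norm_vec_def L2_set_def)
qed (simp_all add: vec_eq_iff axis_def)

lemma bounded_clinear_block_operator:
  assumes "\<And>b y. bounded_clinear (W b y)"
  shows "bounded_clinear (block_operator W)"
  unfolding bounded_clinear_def
proof (intro conjI allI)
  show "bounded_linear (block_operator W)"
    unfolding block_operator_def using assms
    by (intro bounded_linear_vec_lambda bounded_linear_sum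
        bounded_linear_compose[OF _ bounded_linear_vec_nth]) (simp add: bounded_clinear_def)
  show "block_operator W (c *\<^sub>C \<xi>) = c *\<^sub>C block_operator W \<xi>" for c \<xi>
    using assms
    by (simp add: block_operator_def vec_eq_iff scaleC_vec_def bounded_clinear_def
        bounded_linear.linear[OF bounded_linear_scaleC] linear_sum)
qed

text \<open>
  The Gram form of a block operator \<open>W\<close>, in terms of the blocks \<open>\<Sum>\<^sub>b W\<^bsub>b,y\<^esub>\<^sup>* W\<^bsub>b,y'\<^esub>\<close> of \<open>W\<^sup>* W\<close>.
\<close>

lemma inner_block_operator:
  assumes "\<And>b y. bounded_clinear (W b y :: 'h::chilbert_space \<Rightarrow> 'k::complex_inner)"
  shows "inner (block_operator W \<xi>) (block_operator W \<eta>)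
    = (\<Sum>y\<in>UNIV. \<Sum>y'\<in>UNIV. inner (\<Sum>b\<in>UNIV. cadjoint (W b y) (W b y' (\<xi> $ y'))) (\<eta> $ y))"
proof -
  have "inner (block_operator W \<xi>) (block_operator W \<eta>)
    = (\<Sum>b\<in>UNIV. \<Sum>y\<in>UNIV. \<Sum>y'\<in>UNIV. inner (cadjoint (W b y) (W b y' (\<xi> $ y'))) (\<eta> $ y))"
    by (simp add: inner_vec_def block_operator_def inner_sum_left inner_sum_right
        inner_cadjoint[OF assms])
  also have "\<dots> = (\<Sum>y\<in>UNIV. \<Sum>b\<in>UNIV. \<Sum>y'\<in>UNIV. inner (cadjoint (W b y) (W b y' (\<xi> $ y'))) (\<eta> $ y))"
    by (rule sum.swap)
  also have "\<dots> = (\<Sum>y\<in>UNIV. \<Sum>y'\<in>UNIV. \<Sum>b\<in>UNIV. inner (cadjoint (W b y) (W b y' (\<xi> $ y'))) (\<eta> $ y))"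
    by (intro sum.cong[OF refl] sum.swap)
  finally show ?thesis by (simp add: inner_sum_left)
qed

lemma isometry_inner:
  assumes "isometry T"
  shows "inner (T v) (T w) = inner v w"
proof -
  interpret bounded_linear T
    using assms by (simp add: isometry_def bounded_clinear_def)
  show ?thesis
    using assms by (simp add: dot_norm isometry_def flip: add)
qed

text \<open>
  An isometry preserves the real inner product, and testing this on vectors supported in one
  summand isolates a single block of \<open>W\<^sup>* W\<close>.
\<close>

lemma isometry_block_operator_iff:
  assumes W: "\<And>b y. bounded_clinear (W b y :: 'h::chilbert_space \<Rightarrow> 'k::complex_inner)"
  shows "isometry (block_operator W) \<longleftrightarrow>
    (\<forall>y y' v. (\<Sum>b\<in>UNIV. cadjoint (W b y) (W b y' v)) = block_identity y y' v)"
    (is "?L \<longleftrightarrow> (\<forall>y y' v. ?S y y' v = _)")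
proof
  assume ?L
  have S0: "?S y y' 0 = 0" for y y'
  proof (rule vector_eq_rdot[THEN iffD1, rule_format])
    show "inner (?S y y' 0) z = inner 0 z" for z
      using W by (simp add: inner_sum_left inner_cadjoint bounded_clinear_def linear_simps)
  qed
  show "\<forall>y y' v. ?S y y' v = block_identity y y' v"
  proof (intro allI, rule vector_eq_rdot[THEN iffD1, rule_format])
    fix y y' v w
    have "inner (?S y y' v) w = inner (block_operator W (axis y' v)) (block_operator W (axis y w))"
    proof -
      have "inner (?S z z' (axis y' v $ z')) (axis y w $ z)
          = (if z' = y' then if z = y then inner (?S y y' v) w else 0 else 0)" for z z'
        by (simp add: axis_def S0)
      then show ?thesis by (simp add: inner_block_operator[OF W])
    qed
    also have "\<dots> = inner (axis y' v) (axis y w)"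
      by (rule isometry_inner[OF \<open>?L\<close>])
    also have "\<dots> = inner (block_identity y y' v) w"
      by (auto simp: inner_axis_axis block_identity_def)
    finally show "inner (?S y y' v) w = inner (block_identity y y' v) w" .
  qed
next
  assume R: "\<forall>y y' v. ?S y y' v = block_identity y y' v"
  have "inner (block_operator W \<xi>) (block_operator W \<xi>) = inner \<xi> \<xi>" for \<xi>
  proof -
    have "inner (block_identity y y' (\<xi> $ y')) (\<xi> $ y) = (if y' = y then inner (\<xi> $ y) (\<xi> $ y) else 0)" for y y'
      by (auto simp: block_identity_def)
    then show ?thesis
      by (simp only: inner_block_operator[OF W] R) (simp add: inner_vec_def)
  qed
  then show ?L
    by (simp add: isometry_def bounded_clinear_block_operator[OF W] norm_eq_sqrt_inner)
qed

text \<open>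
  \<open>Tr\<^sub>A E\<close> collects the blocks of \<open>V\<^sup>* V\<close>, and \<open>Tr\<^sub>X E\<close> the corresponding blocks for the block
  transpose of \<open>V\<close>.
\<close>

lemma bi_isometry_iff_traces:
  assumes "\<And>a x. V a x \<in> bounded_operators UNIV K"
    and "\<And>x x' a a'. E x x' a a' = cadjoint (V a x) \<circ> V a' x'"
  shows "bi_isometry K V \<longleftrightarrow> trace_A E = block_identity \<and> trace_X E = block_identity"
proof -
  have V: "bounded_clinear (V a x)" for a x
    using assms(1) by (simp add: bounded_operators_def)
  then have V': "bounded_clinear (block_transpose V a x)" for a x
    by (simp add: block_transpose_def)
  show ?thesis
    using assms(1)
    by (simp add: bi_isometry_def isometry_block_operator_iff[OF V] isometry_block_operator_iff[OF V']
        block_transpose_def fun_eq_iff trace_A_def trace_X_def assms(2))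
qed

section \<open>Factorisation\<close>

text \<open>
  \<open>V\<^bsub>a,x\<^esub>\<close> is the column with index \<open>(x,a)\<close> of a square root of \<open>E\<close>. Complex linearity of that
  root comes from its commuting with every bounded operator that commutes with \<open>E\<close>.
\<close>

lemma positive_op_matrix_factorisation:
  fixes E :: "('x::finite, 'h::chilbert_space) op_matrix"
  assumes "positive_op_matrix E"
  obtains V :: "'x \<Rightarrow> 'x \<Rightarrow> 'h \<Rightarrow> 'h ^ ('x \<times> 'x)"
  where "\<And>a x. V a x \<in> bounded_operators UNIV UNIV"
    and "\<And>x x' a a'. E x x' a a' = cadjoint (V a x) \<circ> V a' x'"
proof -
  let ?P = "op_matrix_operator E"
  have P: "positive_operator ?P" using assms by (simp add: positive_op_matrix_def)
  then have blP: "bounded_linear ?P" and cP: "\<And>c \<xi>. ?P (c *\<^sub>C \<xi>) = c *\<^sub>C ?P \<xi>"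
    by (auto simp: positive_operator_def bounded_clinear_def)
  have "0 \<le> inner (?P \<xi>) \<xi>" for \<xi>
    using P by (simp add: positive_operator_def inner_eq_Re_cinner)
  from positive_operator_sqrt[OF blP positive_operator_symmetric[OF P] this]
  obtain T where blT: "bounded_linear T" and symT: "\<And>\<xi> \<eta>. inner (T \<xi>) \<eta> = inner \<xi> (T \<eta>)"
    and TT: "\<And>\<xi>. T (T \<xi>) = ?P \<xi>"
    and comm: "\<And>B \<xi>. bounded_linear B \<Longrightarrow> (\<And>\<xi>. ?P (B \<xi>) = B (?P \<xi>)) \<Longrightarrow> T (B \<xi>) = B (T \<xi>)"
    by blast
  have cT: "T (c *\<^sub>C \<xi>) = c *\<^sub>C T \<xi>" for c \<xi>
    by (rule comm[OF bounded_linear_scaleC cP])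
  define V where "V a x v = T (axis (x, a) v)" for a x v
  have V: "bounded_clinear (V a x)" for a x
    unfolding bounded_clinear_def V_def
    using bounded_linear_compose[OF blT bounded_linear_axis] by (simp add: cT flip: scaleC_axis)
  have entry: "?P (axis (x', a') v) $ (x, a) = E x x' a a' v" for x x' a a' v
  proof -
    have E0: "E x z a b 0 = 0" for z b
      using assms by (simp add: positive_op_matrix_def bounded_operators_def bounded_clinear_def linear_simps)
    have "E x z a b (axis (x', a') v $ (z, b))
        = (if b = a' then if z = x' then E x x' a a' v else 0 else 0)" for z b
      by (simp add: axis_def E0)
    then show ?thesis by (simp add: op_matrix_operator_def)
  qed
  show thesis
  proof
    show "V a x \<in> bounded_operators UNIV UNIV" for a x
      using V by (simp add: bounded_operators_def)
    show "E x x' a a' = cadjoint (V a x) \<circ> V a' x'" for x x' a a'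
    proof (rule ext, rule vector_eq_rdot[THEN iffD1, rule_format])
      fix v w
      have "inner ((cadjoint (V a x) \<circ> V a' x') v) w = inner (V a' x' v) (V a x w)"
        by (simp add: inner_cadjoint[OF V])
      also have "\<dots> = inner (?P (axis (x', a') v)) (axis (x, a) w)"
        unfolding V_def by (simp flip: symT TT)
      also have "\<dots> = inner (E x x' a a' v) w"
        by (simp add: inner_axis entry)
      finally show "inner (E x x' a a' v) w = inner ((cadjoint (V a x) \<circ> V a' x') v) w" ..
    qed
  qed
qed

lemma bistochastic_if_factorisation:
  assumes "positive_op_matrix E" and "bi_isometry K V"
    and "\<forall>x x' a a'. E x x' a a' = cadjoint (V a x) \<circ> V a' x'"
  shows "bistochastic E"
  using assms bi_isometry_iff_traces[of V K E]
  by (simp add: bistochastic_def bi_isometry_def)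

theorem theorem3p2:
  fixes E :: "('x::finite, 'h::chilbert_space) op_matrix"
  assumes "positive_op_matrix E"
  shows "(bistochastic E \<longleftrightarrow>
           (\<exists>(K :: ('h ^ ('x \<times> 'x)) set) (V :: 'x \<Rightarrow> 'x \<Rightarrow> 'h \<Rightarrow> 'h ^ ('x \<times> 'x)).
              hilbert_subspace K \<and> bi_isometry K V \<and>
              (\<forall>x x' a a'. E x x' a a' = cadjoint (V a x) \<circ> V a' x')))
       \<and> ((\<exists>(K :: 'k::chilbert_space set) (V :: 'x \<Rightarrow> 'x \<Rightarrow> 'h \<Rightarrow> 'k).
              hilbert_subspace K \<and> bi_isometry K V \<and>
              (\<forall>x x' a a'. E x x' a a' = cadjoint (V a x) \<circ> V a' x'))
           \<longrightarrow> bistochastic E)"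
proof -
  have necessary: "\<exists>(K :: ('h ^ ('x \<times> 'x)) set) V. hilbert_subspace K \<and> bi_isometry K V \<and>
      (\<forall>x x' a a'. E x x' a a' = cadjoint (V a x) \<circ> V a' x')" if "bistochastic E"
  proof -
    obtain V :: "'x \<Rightarrow> 'x \<Rightarrow> 'h \<Rightarrow> 'h ^ ('x \<times> 'x)"
      where V: "\<And>a x. V a x \<in> bounded_operators UNIV UNIV"
        and E: "\<And>x x' a a'. E x x' a a' = cadjoint (V a x) \<circ> V a' x'"
      using positive_op_matrix_factorisation[OF assms] by blast
    have "bi_isometry UNIV V"
      using that bi_isometry_iff_traces[of V UNIV E, OF V E] by (simp add: bistochastic_def)
    then show ?thesis
      using E by (intro exI[of _ UNIV] exI[of _ V]) (simp add: hilbert_subspace_def)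
  qed
  then show ?thesis
    by (intro conjI iffI impI) (auto intro: bistochastic_if_factorisation[OF assms])
qed

end
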